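(* Let $h$ and $H$ be as below and let $\gamma=0.9214$. Then $H(s)\leqslant \gamma sh(s)$ for $s\geqslant 3$, and $H(3)\leqslant \gamma sh(s)$ for $1\leqslant s\leqslant 3$.
   Context: $h(s)=e^{-2}$ for $1\leqslant s\leqslant 2$, $h(s)=e^{-s}$ for $2\leqslant s\leqslant 3$, $h(s)=3s^{-1}e^{-s}$ for $s\geqslant 3$. For $s\geqslant 2$, $H(s)=\int_s^{\infty}h(t-1)\,dt$. *)

theory Defs
  imports "HOL-Analysis.Analysis"
begin

(* Only arguments s >= 1 are meaningful; the value for s < 1 is a dummy. *)
definition h :: "real \<Rightarrow> real" where
  "h s = (if s \<le> 2 then exp (-2)
          else if s \<le> 3 then exp (-s)
          else 3 * inverse s * exp (-s))"

(* Only arguments s >= 2 are meaningful. *)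
definition H :: "real \<Rightarrow> real" where
  "H s = integral {s..} (\<lambda>t. h (t - 1))"

lemma h_on_pieces:
  "1 \<le> s \<Longrightarrow> s \<le> 2 \<Longrightarrow> h s = exp (-2)"
  "2 \<le> s \<Longrightarrow> s \<le> 3 \<Longrightarrow> h s = exp (-s)"
  "3 \<le> s \<Longrightarrow> h s = 3 * inverse s * exp (-s)"
  by (auto simp: h_def)

(* The integral defining H exists, so integral does not take its default value 0. *)
lemma h_shift_integrable:
  assumes "2 \<le> s"
  shows "(\<lambda>t. h (t - 1)) integrable_on {s..}"
proof (rule measurable_bounded_by_integrable_imp_integrable)
  have "(\<lambda>t. h (t - 1)) \<in> borel_measurable borel"
    unfolding h_def by measurable
  then show "(\<lambda>t. h (t - 1)) \<in> borel_measurable (lebesgue_on {s..})"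
    by (intro measurable_restrict_space1 measurable_completion) simp
  show "(\<lambda>t. exp 1 * exp (- 1 * t)) integrable_on {s..}"
    using has_integral_mult_right[OF has_integral_exp_minus_to_infinity[of 1 s], of "exp 1"]
    by (auto simp: integrable_on_def)
  show "norm (h (t - 1)) \<le> exp 1 * exp (- 1 * t)" if "t \<in> {s..}" for t
  proof -
    have "h (t - 1) \<le> exp (- (t - 1))"
      using assms that by (auto simp: h_def field_simps)
    moreover have "0 \<le> h (t - 1)"
      using assms that by (auto simp: h_def)
    ultimately show ?thesis
      by (simp add: exp_diff exp_minus field_simps)
  qed
qed simp

end

theory Submission
  imports Defs "HOL-Real_Asymp.Real_Asymp"
begin

text \<open>
  The delicate case is \<open>s = 1\<close> of the second claim, where both sides agree to four digits.
  With \<open>H 3 = exp (-2) - exp (-3) + H 4\<close> it reduces to an upper bound on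
  \<open>H 4 = 3 * (\<integral> exp (-x) / x dx over x \<ge> 3)\<close> that is accurate to about \<open>10\<^sup>-\<^sup>4\<close>. It is obtained by
  dominating the integrand by the derivative of \<open>- exp (-x) * P x / Q x\<close>, where \<open>P / Q\<close> is a
  convergent of the continued fraction of \<open>exp x * E\<^sub>1 x\<close>.
\<close>

(* P/Q = (1/x) (1 - 1/(x+2 - 2/(x+4 - 6/(x+6 - 12/(x+8))))); even convergents bound from above. *)
definition P :: "real \<Rightarrow> real" where
  "P x = x ^ 4 + 19 * x ^ 3 + 102 * x\<^sup>2 + 154 * x + 24"

definition Q :: "real \<Rightarrow> real" where
  "Q x = x ^ 5 + 20 * x ^ 4 + 120 * x ^ 3 + 240 * x\<^sup>2 + 120 * x"

lemma Q_pos: "0 < x \<Longrightarrow> 0 < Q x"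
  unfolding Q_def by (intro add_pos_pos) auto

text \<open>The excess over \<open>exp (- x) / x\<close> is positive, so integrating yields an upper
  bound; since \<open>Q\<close> has degree 5, the factor \<open>2880 / (Q x)\<^sup>2\<close> decays
  like the tenth power of \<open>1 / x\<close>.\<close>

lemma deriv_exp_P_Q:
  assumes "0 < x"
  shows "((\<lambda>x. - (exp (- x) * P x / Q x)) has_real_derivative
           exp (- x) * (1 / x + 2880 / (Q x)\<^sup>2)) (at x)"
proof -
  define P' where "P' = 4 * x ^ 3 + 57 * x\<^sup>2 + 204 * x + 154"
  define Q' where "Q' = 5 * x ^ 4 + 80 * x ^ 3 + 360 * x\<^sup>2 + 480 * x + 120"
  have P: "(P has_real_derivative P') (at x)"
    unfolding P_def[abs_def] P'_def by (auto intro!: derivative_eq_intros)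
  have Q: "(Q has_real_derivative Q') (at x)"
    unfolding Q_def[abs_def] Q'_def by (auto intro!: derivative_eq_intros)
  have nz: "Q x \<noteq> 0"
    using Q_pos[OF assms] by simp
  \<comment> \<open>This is where the choice of \<open>P\<close> and \<open>Q\<close> enters: after
    division by \<open>x\<close> everything but a constant cancels, and at 0 that constant is
    \<open>P 0 * Q'\<close> = 24 * 120 = 2880.\<close>
  have ident: "x * (P x * Q x - P' * Q x + P x * Q') = (Q x)\<^sup>2 + 2880 * x"
    unfolding P_def Q_def P'_def Q'_def by algebra
  have "(P x * Q x - P' * Q x + P x * Q') / (Q x)\<^sup>2 = 1 / x + 2880 / (Q x)\<^sup>2"
    using ident nz assms by (simp add: divide_simps) (simp add: algebra_simps)
  moreover have "((\<lambda>x. - (exp (- x) * P x / Q x)) has_real_derivative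
      exp (- x) * ((P x * Q x - P' * Q x + P x * Q') / (Q x)\<^sup>2)) (at x)"
    using nz by (auto intro!: derivative_eq_intros P Q simp: power2_eq_square field_simps)
  ultimately show ?thesis
    by simp
qed

lemma H_4_le: "H 4 \<le> 666 / 847 * exp (-3)"
proof -
  define F where "F t = - (exp (- (t - 1)) * P (t - 1) / Q (t - 1))" for t
  define f where "f t = exp (- (t - 1)) * (1 / (t - 1) + 2880 / (Q (t - 1))\<^sup>2)" for t
  have nonneg: "0 \<le> f t" if "4 \<le> t" for t
    using that unfolding f_def by simp
  have "(f has_integral (- F 4)) {4..}"
  \<comment> \<open>As \<open>f\<close> is nonnegative on \<open>{4..}\<close>, the limit of its
    integrals over \<open>{4..y}\<close> is its integral over the half-line.\<close>
  proof (rule has_integral_to_inf)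
    have FTC: "(f has_integral (F y - F 4)) {4..y}" if "4 \<le> y" for y
    proof (rule fundamental_theorem_of_calculus[OF that])
      fix t assume "t \<in> {4..y}"
      then have "0 < t - 1"
        by simp
      moreover have "((\<lambda>t. t - 1) has_real_derivative 1) (at t)"
        by (auto intro!: derivative_eq_intros)
      ultimately have "(F has_real_derivative f t) (at t)"
        unfolding F_def[abs_def] f_def
        using DERIV_chain2[OF deriv_exp_P_Q, of "\<lambda>t. t - 1" t 1] by simp
      then show "(F has_vector_derivative f t) (at t within {4..y})"
        by (simp add: has_real_derivative_iff_has_vector_derivative has_vector_derivative_at_within)
    qed
    show "f integrable_on {4..y}" for y
      using FTC[of y] by (cases "4 \<le> y") (auto simp: integrable_on_def)
    have "(F \<longlongrightarrow> 0) at_top"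
      unfolding F_def P_def Q_def by real_asymp
    then have "((\<lambda>y. F y - F 4) \<longlongrightarrow> - F 4) at_top"
      by (auto intro!: tendsto_eq_intros)
    moreover have "\<forall>\<^sub>F y in at_top. integral {4..y} f = F y - F 4"
      using eventually_ge_at_top[of 4] by eventually_elim (use FTC in blast)
    ultimately show "((\<lambda>y. integral {4..y} f) \<longlongrightarrow> - F 4) at_top"
      by (simp add: filterlim_cong)
  qed (use nonneg in auto)
  then have f: "((\<lambda>t. 3 * f t) has_integral 3 * (- F 4)) {4..}"
    by (rule has_integral_mult_right)
  have "H 4 \<le> integral {4..} (\<lambda>t. 3 * f t)"
    unfolding H_def
  proof (rule integral_le)
    fix t :: real assume t: "t \<in> {4..}"
    then have "h (t - 1) = 3 * (exp (- (t - 1)) * (1 / (t - 1)))"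
      using h_on_pieces(3)[of "t - 1"] by (simp add: field_simps)
    also have "\<dots> \<le> 3 * f t"
      unfolding f_def by (intro mult_left_mono) auto
    finally show "h (t - 1) \<le> 3 * f t" .
  qed (use f h_shift_integrable in auto)
  \<comment> \<open>\<open>P 3 = 1998\<close> and \<open>Q 3 = 7623\<close>, and
    \<open>3 * 1998 / 7623\<close> reduces to \<open>666 / 847\<close>.\<close>
  also have "\<dots> = 666 / 847 * exp (-3)"
    unfolding integral_unique[OF f] by (simp add: F_def P_def Q_def)
  finally show ?thesis .
qed

text \<open>For \<open>t\<close> in \<open>{s..4}\<close> the argument \<open>t - 1\<close> stays in
  the middle piece of \<open>h\<close>, where the integrand is exactly
  \<open>exp (1 - t)\<close>.\<close>

lemma H_split:
  assumes "3 \<le> s" "s \<le> 4"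
  shows "H s = exp (1 - s) - exp (-3) + H 4"
proof -
  have "((\<lambda>t. exp (1 - t)) has_integral (- exp (1 - 4) - (- exp (1 - s)))) {s..4}"
    using assms(2)
    by (intro fundamental_theorem_of_calculus)
       (auto intro!: derivative_eq_intros
             simp flip: has_real_derivative_iff_has_vector_derivative)
  then have "((\<lambda>t. h (t - 1)) has_integral (- exp (1 - 4) - (- exp (1 - s)))) {s..4}"
    by (rule has_integral_eq[rotated]) (use assms h_on_pieces(2) in auto)
  moreover have "((\<lambda>t. h (t - 1)) has_integral H 4) {4..}"
    unfolding H_def using h_shift_integrable[of 4] by (simp add: has_integral_integral)
  ultimately have "((\<lambda>t. h (t - 1)) has_integral
      (- exp (1 - 4) - (- exp (1 - s)) + H 4)) ({s..4} \<union> {4..})"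
    by (rule has_integral_Un) (auto intro: negligible_subset[of "{4}"])
  also have "{s..4} \<union> {4..} = {s..}"
    using assms by auto
  finally show ?thesis
    unfolding H_def[of s] by (simp add: integral_unique)
qed

lemma H_le_tail:
  assumes "4 \<le> s"
  shows "H s \<le> exp (1 - s)"
proof -
  have e: "((\<lambda>t. exp 1 * exp (- t)) has_integral exp 1 * exp (- s)) {s..}"
    using has_integral_mult_right[OF has_integral_exp_minus_to_infinity[of 1 s], of "exp 1"] by simp
  have "H s \<le> integral {s..} (\<lambda>t. exp 1 * exp (- t))"
    unfolding H_def
  proof (rule integral_le)
    fix t assume "t \<in> {s..}"
    then show "h (t - 1) \<le> exp 1 * exp (- t)"
      using assms by (simp add: h_on_pieces(3) field_simps flip: exp_add)
  qed (use e h_shift_integrable assms in auto)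
  also have "\<dots> = exp (1 - s)"
    using e by (simp add: integral_unique flip: exp_add)
  finally show ?thesis .
qed

text \<open>The constant is \<gamma>. After division by \<open>exp (-2)\<close> the claim is
  \<open>1 - 181 / (847 * e) \<le> 0.9214\<close>, with \<open>181 / 847 = 1 - 666 / 847\<close>;
  the slack is about 0.000014.\<close>

lemma H_3_le: "H 3 \<le> 4607 / 5000 * exp (-2)"
proof -
  have "H 3 \<le> exp (-2) - 181 / 847 * exp (-3)"
    using H_split[of 3] H_4_le by simp
  moreover have "exp (-2) = exp 1 * exp (-3 :: real)"
    by (simp flip: exp_add)
  \<comment> \<open>What is needed is \<open>e \<le> (181 / 847) / 0.0786\<close>, about 2.7187, so
    the coarser bound 2.72 would fail.\<close>
  moreover have "exp 1 * exp (-3) \<le> 27183 / 10000 * exp (-3 :: real)"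
    using e_approx_32 by (intro mult_right_mono) (auto simp: abs_if split: if_splits)
  ultimately show ?thesis
    using exp_gt_zero[of "-3 :: real"] by linarith
qed

text \<open>This reduces the second claim to \<open>s = 1\<close>, where equality holds. On the
  middle piece it amounts to \<open>exp (s - 2) \<le> s\<close>.\<close>

lemma exp_minus_2_le_h:
  assumes "1 \<le> s" "s \<le> 3"
  shows "exp (-2) \<le> s * h s"
proof (cases "s \<le> 2")
  case True
  then show ?thesis
    using assms by (simp add: h_on_pieces)
next
  case False
  have "exp (s - 2) \<le> 1 + (s - 2) + (s - 2)\<^sup>2"
    using False assms by (intro exp_bound) auto
  also have "(s - 2)\<^sup>2 \<le> 1"
    using False assms by (simp add: power_le_one)
  finally have "exp (s - 2) * exp (- s) \<le> s * exp (- s)"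
    by (intro mult_right_mono) auto
  then show ?thesis
    using False assms by (simp add: h_on_pieces flip: exp_add)
qed

theorem theorem6:
  fixes \<gamma> :: real
  assumes "\<gamma> = 0.9214"
  shows "(\<forall>s\<ge>3. H s \<le> \<gamma> * s * h s) \<and>
         (\<forall>s. 1 \<le> s \<and> s \<le> 3 \<longrightarrow> H 3 \<le> \<gamma> * s * h s)"
proof (intro conjI allI impI)
  fix s :: real assume s: "3 \<le> s"
  have e: "exp 1 \<le> (2.72 :: real)"
    using e_less_272 by simp
  have exp_split: "exp (1 - s) = exp 1 * exp (- s)"
    by (simp flip: exp_add)
  have "H s \<le> exp (1 - s)"
  proof (cases "s \<le> 4")
    case True
    \<comment> \<open>Since \<open>666 / 847 < 1\<close>, the part \<open>H 4 - exp (-3)\<close> of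
      \<open>H_split\<close> is negative.\<close>
    have "0 < exp (-3 :: real)"
      by simp
    with True s show ?thesis
      using H_split[of s] H_4_le by linarith
  qed (simp add: H_le_tail)
  \<comment> \<open>2.7642 is 3 * \<gamma>, matching \<open>s * h s = 3 * exp (- s)\<close>; it
    exceeds \<open>e\<close>.\<close>
  also have "\<dots> \<le> 2.7642 * exp (- s)"
    unfolding exp_split using e by (intro mult_right_mono) auto
  also have "\<dots> = \<gamma> * s * h s"
    using s assms by (simp add: h_on_pieces(3))
  finally show "H s \<le> \<gamma> * s * h s" .
next
  fix s :: real assume "1 \<le> s \<and> s \<le> 3"
  then have "4607 / 5000 * exp (-2) \<le> 4607 / 5000 * (s * h s)"
    by (intro mult_left_mono exp_minus_2_le_h) auto
  also have "\<dots> = \<gamma> * s * h s"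
    using assms by simp
  finally show "H 3 \<le> \<gamma> * s * h s"
    using H_3_le by linarith
qed

end
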